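(* Let $Q=(q_{ij})$ be a real symmetric $n\times n$ matrix with zero diagonal, $c\in\mathbb{R}^n$, $R_i=\{j:q_{ij}\neq0\}$, $R^+_i=\{j:q_{ij}>0\}$, $R^-_i=\{j:q_{ij}<0\}$, and let $\beta_{ij}>0$ for $j\in R^+_i$, $i=1,\dots,n$. Consider the MILP ORPK($*,\beta$) in variables $x_i$ and $y_{ij}$ ($j\in R_i$): maximize $\sum_{i=1}^n\sum_{j\in R_i}q_{ij}y_{ij}+\sum_{i=1}^n c_ix_i$ subject to $x_i+x_j-y_{ij}\le 1$ for all $j\in R^-_i$, $i=1,\dots,n$; $\sum_{j\in R^+_i}\beta_{ij}(y_{ij}+y_{ji})\le 2\left(\sum_{j\in R^+_i}\beta_{ij}\right)x_i$ for $i=1,\dots,n$; $x_i\in\{0,1\}$ for all $i$; $y_{ij}\ge 0$ for all $j\in R_i$, $i=1,\dots,n$; $y_{ij}\le 1$ for all $j\in R^+_i$, $i=1,\dots,n$. Then ORPK($*,\beta$) is a valid (optimality restricted) formulation of QUBO.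
   Context: QUBO is the problem: maximize $\sum_{i=1}^n\sum_{j\in R_i}q_{ij}x_ix_j+\sum_{i=1}^n c_ix_i$ over $x\in\{0,1\}^n$. An MILP in variables $(x,y)$ with objective $\sum_i\sum_{j\in R_i}q_{ij}y_{ij}+\sum_i c_ix_i$ is a valid (optimality restricted) formulation of QUBO if its optimal objective value equals the optimal value of QUBO and the $x$-part of every optimal solution of the MILP is an optimal solution of QUBO (the variables $y_{ij}$ need only equal $x_ix_j$ at optimal solutions). *)

theory Defs
  imports "HOL-Analysis.Analysis" "HOL-Library.FuncSet"
begin

definition R :: "real^'n^'n \<Rightarrow> 'n \<Rightarrow> 'n set" where
  "R Q i = {j. Q $ i $ j \<noteq> 0}"

definition R_pos :: "real^'n^'n \<Rightarrow> 'n \<Rightarrow> 'n set" where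
  "R_pos Q i = {j. Q $ i $ j > 0}"

definition R_neg :: "real^'n^'n \<Rightarrow> 'n \<Rightarrow> 'n set" where
  "R_neg Q i = {j. Q $ i $ j < 0}"

definition binary_vector :: "real^'n \<Rightarrow> bool" where
  "binary_vector x \<longleftrightarrow> (\<forall>i. x $ i \<in> {0, 1})"

definition qubo_objective :: "real^'n^'n \<Rightarrow> real^'n \<Rightarrow> real^'n \<Rightarrow> real" where
  "qubo_objective Q c x =
     (\<Sum>i\<in>UNIV. \<Sum>j\<in>R Q i. Q $ i $ j * x $ i * x $ j) + (\<Sum>i\<in>UNIV. c $ i * x $ i)"

text \<open>A point of an MILP is a pair \<open>(x, y)\<close>. There is one variable \<open>y (i, j)\<close>
  for each \<open>i\<close> and each \<open>j \<in> R Q i\<close>, and no others: \<open>y\<close> ranges over the functions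
  that are extensional on the index set below.\<close>

type_synonym 'n milp_point = "(real^'n) \<times> ('n \<times> 'n \<Rightarrow> real)"

definition y_indices :: "real^'n^'n \<Rightarrow> ('n \<times> 'n) set" where
  "y_indices Q = (SIGMA i:UNIV. R Q i)"

definition milp_objective :: "real^'n^'n \<Rightarrow> real^'n \<Rightarrow> 'n milp_point \<Rightarrow> real" where
  "milp_objective Q c = (\<lambda>(x, y).
     (\<Sum>i\<in>UNIV. \<Sum>j\<in>R Q i. Q $ i $ j * y (i, j)) + (\<Sum>i\<in>UNIV. c $ i * x $ i))"

definition ORPK_feasible ::
  "real^'n^'n \<Rightarrow> ('n \<Rightarrow> 'n \<Rightarrow> real) \<Rightarrow> 'n milp_point \<Rightarrow> bool" where
  "ORPK_feasible Q \<beta> = (\<lambda>(x, y).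
     y \<in> extensional (y_indices Q) \<and>
     (\<forall>i. \<forall>j\<in>R_neg Q i. x $ i + x $ j - y (i, j) \<le> 1) \<and>
     (\<forall>i. (\<Sum>j\<in>R_pos Q i. \<beta> i j * (y (i, j) + y (j, i))) \<le> 2 * (\<Sum>j\<in>R_pos Q i. \<beta> i j) * x $ i) \<and>
     binary_vector x \<and>
     (\<forall>i. \<forall>j\<in>R Q i. y (i, j) \<ge> 0) \<and>
     (\<forall>i. \<forall>j\<in>R_pos Q i. y (i, j) \<le> 1))"

text \<open>The optimal value is required to be attained: \<open>v\<close> is the maximum of \<open>f\<close>
  over the points satisfying \<open>P\<close>.\<close>

definition has_optimal_value :: "('a \<Rightarrow> real) \<Rightarrow> ('a \<Rightarrow> bool) \<Rightarrow> real \<Rightarrow> bool" where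
  "has_optimal_value f P v \<longleftrightarrow> (\<exists>z. is_arg_max f P z \<and> f z = v)"

definition valid_QUBO_formulation ::
  "real^'n^'n \<Rightarrow> real^'n \<Rightarrow> ('n milp_point \<Rightarrow> bool) \<Rightarrow> bool" where
  "valid_QUBO_formulation Q c feasible \<longleftrightarrow>
     (\<exists>v. has_optimal_value (milp_objective Q c) feasible v \<and>
          has_optimal_value (qubo_objective Q c) binary_vector v) \<and>
     (\<forall>x y. is_arg_max (milp_objective Q c) feasible (x, y) \<longrightarrow>
            is_arg_max (qubo_objective Q c) binary_vector x)"

end

theory Submission
  imports Defs
begin

text \<open>Every feasible point satisfies \<open>y (i, j) \<le> x\<^sub>i x\<^sub>j\<close> where \<open>q\<^sub>i\<^sub>j > 0\<close> and
  \<open>y (i, j) \<ge> x\<^sub>i x\<^sub>j\<close> where \<open>q\<^sub>i\<^sub>j < 0\<close>, so its value is at most the QUBO value of \<open>x\<close>;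
  the point \<open>y (i, j) = x\<^sub>i x\<^sub>j\<close> is feasible and attains this bound.
  The first inequality holds because the aggregated constraint of \<open>i\<close>
  forces all its nonnegative summands to vanish when \<open>x\<^sub>i = 0\<close>; as it contains both
  \<open>y (i, j)\<close> and \<open>y (j, i)\<close>, the symmetry of \<open>Q\<close> gives the same when \<open>x\<^sub>j = 0\<close>.\<close>

text \<open>Finiteness makes QUBO attain its maximum. The MILP may have infinitely many feasible
  points, so its maximum is obtained from that of QUBO instead.\<close>

lemma finite_binary_vectors: "finite {x :: real^'n. binary_vector x}"
proof (rule finite_subset)
  show "{x :: real^'n. binary_vector x} \<subseteq> vec_lambda ` (UNIV \<rightarrow>\<^sub>E {0, 1})"
  proof
    fix x :: "real^'n"
    assume "x \<in> {x. binary_vector x}"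
    then have "($) x \<in> UNIV \<rightarrow>\<^sub>E {0, 1}"
      by (auto simp: binary_vector_def PiE_def)
    moreover have "x = vec_lambda (($) x)"
      by simp
    ultimately show "x \<in> vec_lambda ` (UNIV \<rightarrow>\<^sub>E {0, 1})"
      by blast
  qed
  show "finite (vec_lambda ` (UNIV \<rightarrow>\<^sub>E {0, 1}) :: (real^'n) set)"
    by (intro finite_imageI finite_PiE) auto
qed

lemma is_arg_max_exists:
  fixes f :: "'a \<Rightarrow> real"
  assumes "finite {x. P x}" and "P a"
  obtains z where "is_arg_max f P z"
proof -
  let ?S = "f ` {x. P x}"
  have "finite ?S" and "?S \<noteq> {}"
    using assms by auto
  then have "Max ?S \<in> ?S" and max: "\<And>x. P x \<Longrightarrow> f x \<le> Max ?S"
    by (rule Max_in, auto)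
  then obtain z where "P z" and "f z = Max ?S"
    by auto
  with max show thesis
    by (intro that[of z]) (auto simp: is_arg_max_linorder)
qed

text \<open>The restriction is there because feasibility requires the second component to be
  extensional on \<open>y_indices Q\<close>.\<close>

definition product_point :: "real^'n^'n \<Rightarrow> real^'n \<Rightarrow> 'n milp_point" where
  "product_point Q x = (x, restrict (\<lambda>(i, j). x $ i * x $ j) (y_indices Q))"

lemma product_point_objective:
  "milp_objective Q c (product_point Q x) = qubo_objective Q c x"
  by (auto simp: product_point_def milp_objective_def qubo_objective_def y_indices_def
      mult.assoc intro!: sum.cong)

lemma symmetric_nth:
  assumes "transpose Q = Q"
  shows "Q $ i $ j = Q $ j $ i"
proof -
  have "Q $ i $ j = transpose Q $ i $ j"
    using assms by simp
  then show ?thesis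
    by (simp add: transpose_def)
qed

lemma product_point_feasible:
  fixes Q :: "real^'n^'n"
  assumes sym: "transpose Q = Q"
    and \<beta>: "\<And>i j. j \<in> R_pos Q i \<Longrightarrow> \<beta> i j > 0"
    and x: "binary_vector x"
  shows "ORPK_feasible Q \<beta> (product_point Q x)"
proof -
  define y where "y = restrict (\<lambda>(i, j). x $ i * x $ j) (y_indices Q)"
  have y: "y (i, j) = x $ i * x $ j" if "j \<in> R Q i" for i j
    using that by (simp add: y_def y_indices_def)
  have x01: "x $ i = 0 \<or> x $ i = 1" for i
    using x by (auto simp: binary_vector_def)
  \<comment> \<open>The row constraint of \<open>i\<close> also mentions \<open>y (j, i)\<close>;
    symmetry ensures that \<open>(j, i)\<close> is an index, so that this value is a product
    too.\<close>
  have pos: "j \<in> R Q i" "i \<in> R Q j" if "j \<in> R_pos Q i" for i j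
    using that symmetric_nth[OF sym, of i j] by (auto simp: R_def R_pos_def)
  have neg: "j \<in> R Q i" if "j \<in> R_neg Q i" for i j
    using that by (auto simp: R_def R_neg_def)
  have bounds: "0 \<le> x $ i * x $ j" "x $ i * x $ j \<le> x $ i" "x $ i * x $ j \<le> 1"
    "x $ i + x $ j - x $ i * x $ j \<le> 1" for i j
    using x01[of i] x01[of j] by auto
  have row: "(\<Sum>j\<in>R_pos Q i. \<beta> i j * (y (i, j) + y (j, i)))
      \<le> 2 * (\<Sum>j\<in>R_pos Q i. \<beta> i j) * x $ i" for i
  proof -
    \<comment> \<open>Each of the two products in a summand is at most \<open>x $ i\<close>;
      weighting with \<beta> and summing gives the row constraint.\<close>
    have "(\<Sum>j\<in>R_pos Q i. \<beta> i j * (y (i, j) + y (j, i)))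
        \<le> (\<Sum>j\<in>R_pos Q i. \<beta> i j * (2 * x $ i))"
    proof (rule sum_mono)
      fix j assume j: "j \<in> R_pos Q i"
      have "y (i, j) + y (j, i) \<le> 2 * x $ i"
        using bounds(2)[of i j] by (simp add: y pos j mult.commute)
      then show "\<beta> i j * (y (i, j) + y (j, i)) \<le> \<beta> i j * (2 * x $ i)"
        using \<beta>[OF j] by (intro mult_left_mono) auto
    qed
    then show ?thesis
      by (simp add: sum_distrib_left sum_distrib_right ac_simps)
  qed
  have "y \<in> extensional (y_indices Q)"
    by (simp add: y_def)
  with row bounds x have "ORPK_feasible Q \<beta> (x, y)"
    by (simp add: ORPK_feasible_def y pos neg)
  then show ?thesis
    by (simp add: product_point_def y_def)
qed

lemma feasible_zero_row:
  fixes Q :: "real^'n^'n"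
  assumes sym: "transpose Q = Q"
    and \<beta>: "\<And>i j. j \<in> R_pos Q i \<Longrightarrow> \<beta> i j > 0"
    and feasible: "ORPK_feasible Q \<beta> (x, y)"
    and j: "j \<in> R_pos Q i" and "x $ i = 0"
  shows "y (i, j) = 0" and "y (j, i) = 0"
proof -
  \<comment> \<open>The sign constraint covers indices only, so the bound on \<open>y (k, i)\<close>
    needs the symmetry of \<open>Q\<close>.\<close>
  have nonneg: "y (i, k) \<ge> 0" "y (k, i) \<ge> 0" if "k \<in> R_pos Q i" for k
    using that feasible symmetric_nth[OF sym, of i k]
    by (auto simp: ORPK_feasible_def R_def R_pos_def)
  have terms: "\<beta> i k * (y (i, k) + y (k, i)) \<ge> 0" if "k \<in> R_pos Q i" for k
    using nonneg[OF that] \<beta>[OF that] by simp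
  have "(\<Sum>k\<in>R_pos Q i. \<beta> i k * (y (i, k) + y (k, i)))
      \<le> 2 * (\<Sum>k\<in>R_pos Q i. \<beta> i k) * x $ i"
    using feasible by (simp add: ORPK_feasible_def)
  then have "(\<Sum>k\<in>R_pos Q i. \<beta> i k * (y (i, k) + y (k, i))) \<le> 0"
    using \<open>x $ i = 0\<close> by simp
  then have "(\<Sum>k\<in>R_pos Q i. \<beta> i k * (y (i, k) + y (k, i))) = 0"
    using terms by (intro antisym sum_nonneg)
  then have "\<beta> i j * (y (i, j) + y (j, i)) = 0"
    using terms j by (subst (asm) sum_nonneg_eq_0_iff) auto
  then show "y (i, j) = 0" and "y (j, i) = 0"
    using nonneg[OF j] \<beta>[OF j] by auto
qed

lemma feasible_objective_le:
  fixes Q :: "real^'n^'n"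
  assumes sym: "transpose Q = Q"
    and \<beta>: "\<And>i j. j \<in> R_pos Q i \<Longrightarrow> \<beta> i j > 0"
    and feasible: "ORPK_feasible Q \<beta> (x, y)"
  shows "milp_objective Q c (x, y) \<le> qubo_objective Q c x"
proof -
  have x01: "x $ i = 0 \<or> x $ i = 1" for i
    using feasible by (auto simp: ORPK_feasible_def binary_vector_def)
  have "Q $ i $ j * y (i, j) \<le> Q $ i $ j * (x $ i * x $ j)" if "j \<in> R Q i" for i j
  proof (cases "Q $ i $ j > 0")
    case True
    then have ij: "j \<in> R_pos Q i" and ji: "i \<in> R_pos Q j"
      using symmetric_nth[OF sym, of i j] by (simp_all add: R_pos_def)
    have "y (i, j) \<le> 1"
      using feasible ij by (simp add: ORPK_feasible_def)
    \<comment> \<open>If both entries are 1, the bound \<open>y (i, j) \<le> 1\<close> suffices. If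
      \<open>x $ i = 0\<close>, row \<open>i\<close> applies; if \<open>x $ j = 0\<close>, row
      \<open>j\<close> does, where \<open>y (i, j)\<close> is the transposed variable.\<close>
    then have "y (i, j) \<le> x $ i * x $ j"
      using x01[of i] x01[of j] feasible_zero_row(1)[OF sym \<beta> feasible ij]
        feasible_zero_row(2)[OF sym \<beta> feasible ji] by auto
    then show ?thesis
      using True by (intro mult_left_mono) auto
  next
    case False
    with that have "j \<in> R_neg Q i"
      by (auto simp: R_def R_neg_def)
    then have "x $ i + x $ j - y (i, j) \<le> 1" and "y (i, j) \<ge> 0"
      using feasible that by (simp_all add: ORPK_feasible_def)
    \<comment> \<open>For binary values the product is the maximum of 0 and
      \<open>x $ i + x $ j - 1\<close>.\<close>
    then have "x $ i * x $ j \<le> y (i, j)"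
      using x01[of i] x01[of j] by auto
    then show ?thesis
      using False by (intro mult_left_mono_neg) auto
  qed
  then show ?thesis
    by (auto simp: milp_objective_def qubo_objective_def mult.assoc intro!: sum_mono)
qed

theorem theorem15:
  fixes Q :: "real^'n^'n" and c :: "real^'n" and \<beta> :: "'n \<Rightarrow> 'n \<Rightarrow> real"
  assumes "transpose Q = Q"
    and "\<And>i. Q $ i $ i = 0"
    and "\<And>i j. j \<in> R_pos Q i \<Longrightarrow> \<beta> i j > 0"
  shows "valid_QUBO_formulation Q c (ORPK_feasible Q \<beta>)"
proof -
  have lift: "ORPK_feasible Q \<beta> (product_point Q x)" if "binary_vector x" for x
    using assms(1,3) that by (rule product_point_feasible)
  have le: "milp_objective Q c (x, y) \<le> qubo_objective Q c x"
    if "ORPK_feasible Q \<beta> (x, y)" for x y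
    using assms(1,3) that by (rule feasible_objective_le)
  have binary: "binary_vector x" if "ORPK_feasible Q \<beta> (x, y)" for x y
    using that by (simp add: ORPK_feasible_def)
  have "binary_vector (0 :: real^'n)"
    by (simp add: binary_vector_def)
  then obtain z where z: "is_arg_max (qubo_objective Q c) binary_vector z"
    using is_arg_max_exists[OF finite_binary_vectors] by blast
  \<comment> \<open>The QUBO values of \<open>x\<close> and then \<open>z\<close> lie in
    between.\<close>
  have "milp_objective Q c (x, y) \<le> milp_objective Q c (product_point Q z)"
    if "ORPK_feasible Q \<beta> (x, y)" for x y
    using le[OF that] z binary[OF that]
    by (force simp: product_point_objective is_arg_max_linorder)
  then have "is_arg_max (milp_objective Q c) (ORPK_feasible Q \<beta>) (product_point Q z)"
    using lift z by (auto simp: is_arg_max_linorder)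
  then have "\<exists>v. has_optimal_value (milp_objective Q c) (ORPK_feasible Q \<beta>) v \<and>
      has_optimal_value (qubo_objective Q c) binary_vector v"
    using z product_point_objective unfolding has_optimal_value_def by blast
  moreover have "is_arg_max (qubo_objective Q c) binary_vector x"
    if opt: "is_arg_max (milp_objective Q c) (ORPK_feasible Q \<beta>) (x, y)" for x y
  proof -
    have feasible: "ORPK_feasible Q \<beta> (x, y)"
      using opt by (simp add: is_arg_max_linorder)
    have "qubo_objective Q c w \<le> qubo_objective Q c x" if "binary_vector w" for w
    proof -
      \<comment> \<open>The optimal point competes with the product point of \<open>w\<close>;
        \<open>y\<close> itself need not consist of products.\<close>
      have "qubo_objective Q c w \<le> milp_objective Q c (x, y)"
        using opt lift[OF that] by (metis is_arg_max_linorder product_point_objective)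
      also have "\<dots> \<le> qubo_objective Q c x"
        by (rule le[OF feasible])
      finally show ?thesis .
    qed
    with binary[OF feasible] show ?thesis
      by (simp add: is_arg_max_linorder)
  qed
  ultimately show ?thesis
    by (simp add: valid_QUBO_formulation_def)
qed

end
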